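(* Let $a<b$ be real numbers and let $f:[a,b]\to\mathbb{R}$ be a nonnegative and convex function. Then $$\frac{2f(a)}{(b-a)^2}\int_a^b (b-x)f(x)\,dx+\frac{2f(b)}{(b-a)^2}\int_a^b (x-a)f(x)\,dx\le \frac{1}{b-a}\int_a^b f^2(x)\,dx+\frac{M(a,b)}{3},$$ where $M(a,b)=f^2(a)+f(a)f(b)+f^2(b)$.
   Context: Here $f^2(x)$ denotes $(f(x))^2$. *)

theory Defs
  imports "HOL-Analysis.Analysis"
begin

end

theory Submission
  imports Defs
begin

text \<open>
  Let \<open>L\<close> be the affine function that agrees with \<open>f\<close> at \<open>a\<close> and \<open>b\<close>, so that
  \<open>(b - a) * L x = (b - x) * f a + (x - a) * f b\<close>.  The left-hand side of the inequality is
  \<open>2 / (b - a)\<close> times the integral of \<open>L * f\<close>, and the mean value of \<open>L\<^sup>2\<close> on \<open>[a, b]\<close> is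
  \<open>((f a)\<^sup>2 + f a * f b + (f b)\<^sup>2) / 3\<close>.  Hence the claim is the integral of
  \<open>2 * L x * f x \<le> (f x)\<^sup>2 + (L x)\<^sup>2\<close>.  Convexity and nonnegativity enter only through
  integrability: they make \<open>f\<close> bounded on \<open>[a, b]\<close> and continuous on the open interval (it may
  jump at the end points).
\<close>

lemma integrable_on_Icc_if_bounded_continuous_Ioo:
  fixes g :: "real \<Rightarrow> real"
  assumes cont: "continuous_on {a<..<b} g"
    and bound: "\<And>x. x \<in> {a<..<b} \<Longrightarrow> \<bar>g x\<bar> \<le> B"
  shows "g integrable_on {a..b}"
proof -
  have "g \<in> borel_measurable (lebesgue_on {a<..<b})"
    by (intro continuous_imp_measurable_on_sets_lebesgue cont) auto
  moreover have "(\<lambda>_. B) integrable_on {a<..<b}"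
    by (metis integrable_const_ivl integrable_on_Icc_iff_Ioo)
  ultimately have "g integrable_on {a<..<b}"
    by (rule measurable_bounded_by_integrable_imp_integrable) (auto intro: bound)
  then show ?thesis
    by (simp add: integrable_on_Icc_iff_Ioo)
qed

lemma convex_on_Icc_le_max:
  fixes f :: "real \<Rightarrow> real"
  assumes "convex_on {a..b} f" "x \<in> {a..b}"
  shows "f x \<le> max (f a) (f b)"
proof -
  have "x \<in> convex hull {a, b}"
    using assms(2) by (simp add: segment_convex_hull[symmetric] closed_segment_eq_real_ivl)
  moreover have "convex_on (convex hull {a, b}) f"
    using assms by (simp add: segment_convex_hull[symmetric] closed_segment_eq_real_ivl)
  ultimately show ?thesis
    using convex_on_convex_hull_bound[of "{a, b}" f "max (f a) (f b)"] by auto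
qed

lemma has_integral_affine_squared:
  fixes a b p k :: real
  assumes "a \<le> b"
  shows "((\<lambda>x. (p + k * (x - a))\<^sup>2) has_integral
           p\<^sup>2 * (b - a) + p * k * (b - a)\<^sup>2 + k\<^sup>2 * (b - a) ^ 3 / 3) {a..b}"
proof -
  let ?F = "\<lambda>x. p\<^sup>2 * (x - a) + p * k * (x - a)\<^sup>2 + k\<^sup>2 * (x - a) ^ 3 / 3"
  have "((\<lambda>x. (p + k * (x - a))\<^sup>2) has_integral ?F b - ?F a) {a..b}"
    by (rule fundamental_theorem_of_calculus[OF assms])
      (auto simp: has_real_derivative_iff_has_vector_derivative[symmetric] power2_eq_square
        field_simps intro!: derivative_eq_intros)
  then show ?thesis by simp
qed

theorem theorem2p1:
  fixes a b :: real and f :: "real \<Rightarrow> real"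
  assumes "a < b"
    and "\<And>x. x \<in> {a..b} \<Longrightarrow> 0 \<le> f x"
    and "convex_on {a..b} f"
  shows "2 * f a / (b - a)\<^sup>2 * integral {a..b} (\<lambda>x. (b - x) * f x)
       + 2 * f b / (b - a)\<^sup>2 * integral {a..b} (\<lambda>x. (x - a) * f x)
      \<le> 1 / (b - a) * integral {a..b} (\<lambda>x. (f x)\<^sup>2)
       + ((f a)\<^sup>2 + f a * f b + (f b)\<^sup>2) / 3"
proof -
  define d where "d = b - a"
  define k where "k = (f b - f a) / d"
  define L where "L = (\<lambda>x. f a + k * (x - a))"
  define B where "B = max (f a) (f b)"
  have d: "d > 0" using assms(1) by (simp add: d_def)
  have kd: "k * d = f b - f a" using d by (simp add: k_def)
  have L_chord: "d * L x = (b - x) * f a + (x - a) * f b" for x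
  proof -
    have "d * L x = d * f a + (k * d) * (x - a)" by (simp add: L_def algebra_simps)
    also have "\<dots> = (b - x) * f a + (x - a) * f b" unfolding kd by (simp add: d_def algebra_simps)
    finally show ?thesis .
  qed

  have cont: "continuous_on {a<..<b} f"
    by (rule convex_on_continuous) (auto intro: convex_on_subset[OF assms(3)])
  have fB: "0 \<le> f x" "f x \<le> B" if "x \<in> {a..b}" for x
    using that assms(2) convex_on_Icc_le_max[OF assms(3)] by (auto simp: B_def)
  have B: "0 \<le> B" using fB[of a] assms(1) by simp
  have int_left: "(\<lambda>x. (b - x) * f x) integrable_on {a..b}"
  proof (rule integrable_on_Icc_if_bounded_continuous_Ioo)
    show "\<bar>(b - x) * f x\<bar> \<le> d * B" if "x \<in> {a<..<b}" for x
      using that fB[of x] B unfolding abs_mult by (intro mult_mono) (auto simp: d_def)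
  qed (intro continuous_intros cont)
  have int_right: "(\<lambda>x. (x - a) * f x) integrable_on {a..b}"
  proof (rule integrable_on_Icc_if_bounded_continuous_Ioo)
    show "\<bar>(x - a) * f x\<bar> \<le> d * B" if "x \<in> {a<..<b}" for x
      using that fB[of x] B unfolding abs_mult by (intro mult_mono) (auto simp: d_def)
  qed (intro continuous_intros cont)
  have int_sq: "(\<lambda>x. (f x)\<^sup>2) integrable_on {a..b}"
  proof (rule integrable_on_Icc_if_bounded_continuous_Ioo)
    show "\<bar>(f x)\<^sup>2\<bar> \<le> B\<^sup>2" if "x \<in> {a<..<b}" for x
      using that fB[of x] by (auto intro: power_mono)
  qed (intro continuous_intros cont)

  have int_L: "((\<lambda>x. (L x)\<^sup>2) has_integral
      d * (((f a)\<^sup>2 + f a * f b + (f b)\<^sup>2) / 3)) {a..b}"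
  proof -
    have "(f a)\<^sup>2 * d + f a * k * d\<^sup>2 + k\<^sup>2 * d ^ 3 / 3
        = d * ((f a)\<^sup>2 + f a * (k * d) + (k * d)\<^sup>2 / 3)"
      by (simp add: power2_eq_square power3_eq_cube algebra_simps)
    also have "\<dots> = d * (((f a)\<^sup>2 + f a * f b + (f b)\<^sup>2) / 3)"
      unfolding kd by (simp add: power2_eq_square field_simps)
    finally have eq: "(f a)\<^sup>2 * d + f a * k * d\<^sup>2 + k\<^sup>2 * d ^ 3 / 3
        = d * (((f a)\<^sup>2 + f a * f b + (f b)\<^sup>2) / 3)" .
    show ?thesis
      using has_integral_affine_squared[of a b "f a" k, folded d_def, unfolded eq] assms(1)
      unfolding L_def by simp
  qed

  let ?I = "integral {a..b} (\<lambda>x. (b - x) * f x)"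
  let ?J = "integral {a..b} (\<lambda>x. (x - a) * f x)"
  let ?S = "integral {a..b} (\<lambda>x. (f x)\<^sup>2)"
  let ?M = "((f a)\<^sup>2 + f a * f b + (f b)\<^sup>2) / 3"
  have lhs: "((\<lambda>x. 2 * f a / d * ((b - x) * f x) + 2 * f b / d * ((x - a) * f x))
      has_integral 2 * f a / d * ?I + 2 * f b / d * ?J) {a..b}"
    by (intro has_integral_add has_integral_mult_right integrable_integral int_left int_right)
  have rhs: "((\<lambda>x. (f x)\<^sup>2 + (L x)\<^sup>2) has_integral ?S + d * ?M) {a..b}"
    by (intro has_integral_add integrable_integral int_sq int_L)
  have "2 * f a / d * ((b - x) * f x) + 2 * f b / d * ((x - a) * f x)
      \<le> (f x)\<^sup>2 + (L x)\<^sup>2" for x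
  proof -
    have "2 * f a / d * ((b - x) * f x) + 2 * f b / d * ((x - a) * f x)
        = 2 * (((b - x) * f a + (x - a) * f b) / d) * f x"
      using d by (simp add: field_simps)
    also have "\<dots> = 2 * L x * f x"
      using d by (simp flip: L_chord)
    also have "\<dots> \<le> (f x)\<^sup>2 + (L x)\<^sup>2"
      using sum_squares_bound[of "L x" "f x"] by simp
    finally show ?thesis .
  qed
  then have "2 * f a / d * ?I + 2 * f b / d * ?J \<le> ?S + d * ?M"
    using has_integral_le[OF lhs rhs] by blast
  then have "(2 * f a / d * ?I + 2 * f b / d * ?J) / d \<le> (?S + d * ?M) / d"
    using d by (intro divide_right_mono) auto
  moreover have "(2 * f a / d * ?I + 2 * f b / d * ?J) / d
      = 2 * f a / d\<^sup>2 * ?I + 2 * f b / d\<^sup>2 * ?J"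
    by (simp add: power2_eq_square add_divide_distrib)
  moreover have "(?S + d * ?M) / d = 1 / d * ?S + ?M"
    using d by (simp add: add_divide_distrib)
  ultimately show ?thesis
    unfolding d_def by simp
qed

end
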